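(* Let $G$ be a torsion group and let $n\in \pi_e(G)$ be such that $\Omega(n)$ is maximum among all elements of $\pi_e(G)$. Then: (1) $\mathcal{RP}(G)$ is $(\Omega(n)+1)$-partite; (2) $\omega(\mathcal{RP}(G))=\Omega(n)+1=\chi(\mathcal{RP}(G))$; and so $\mathcal{RP}(G)$ is weakly $\chi$-perfect.
   Context: For a group $G$, the reduced power graph $\mathcal{RP}(G)$ is the simple graph with vertex set $G$ in which $u,v$ are adjacent if and only if $\langle v\rangle\subset\langle u\rangle$ or $\langle u\rangle\subset\langle v\rangle$, where $\subset$ means proper inclusion. $\pi_e(G)$ denotes the set of orders of elements of $G$. $\Omega(n)$ is the number of prime factors of $n$ counted with multiplicity. $\omega$ denotes the clique number and $\chi$ the chromatic number of a graph. A graph $\Gamma$ is weakly $\chi$-perfect if $\omega(\Gamma)=\chi(\Gamma)$. *)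

theory Defs
  imports
    "HOL-Algebra.Algebra"
    "HOL-Library.Extended_Nat"
    "HOL-Library.Disjoint_Sets"
    "HOL-Library.Ramsey"
begin

record 'a ugraph =
  vertices :: "'a set"
  edges :: "'a set set"

definition simple_ugraph :: "'a ugraph \<Rightarrow> bool" where
  "simple_ugraph \<Gamma> \<longleftrightarrow> (\<forall>e\<in>edges \<Gamma>. e \<subseteq> vertices \<Gamma> \<and> card e = 2)"

text \<open>
  Graphs may be infinite, so the clique number and the chromatic number are extended naturals.
  Taking the supremum over finite cliques only is no restriction: subsets of cliques are cliques,
  so an infinite clique already forces the value \<open>\<infinity>\<close>. If there is no finite proper colouring,
  the chromatic number is the infimum of the empty set, which is \<open>\<infinity>\<close>.
\<close>

definition clique_number :: "'a ugraph \<Rightarrow> enat" where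
  "clique_number \<Gamma> =
     Sup {enat (card K) | K. K \<subseteq> vertices \<Gamma> \<and> finite K \<and> clique K (edges \<Gamma>)}"

definition proper_colouring :: "'a ugraph \<Rightarrow> nat \<Rightarrow> ('a \<Rightarrow> nat) \<Rightarrow> bool" where
  "proper_colouring \<Gamma> k c \<longleftrightarrow>
     c ` vertices \<Gamma> \<subseteq> {..<k} \<and>
     (\<forall>u\<in>vertices \<Gamma>. \<forall>v\<in>vertices \<Gamma>. {u, v} \<in> edges \<Gamma> \<longrightarrow> c u \<noteq> c v)"

definition chromatic_number :: "'a ugraph \<Rightarrow> enat" where
  "chromatic_number \<Gamma> = Inf {enat k | k. \<exists>c. proper_colouring \<Gamma> k c}"

definition weakly_chi_perfect :: "'a ugraph \<Rightarrow> bool" where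
  "weakly_chi_perfect \<Gamma> \<longleftrightarrow> clique_number \<Gamma> = chromatic_number \<Gamma>"

text \<open>The \<open>k\<close> parts are required to be nonempty (this is part of \<^const>\<open>partition_on\<close>).\<close>

definition k_partite :: "nat \<Rightarrow> 'a ugraph \<Rightarrow> bool" where
  "k_partite k \<Gamma> \<longleftrightarrow>
     (\<exists>P. partition_on (vertices \<Gamma>) P \<and> finite P \<and> card P = k \<and>
          (\<forall>S\<in>P. indep S (edges \<Gamma>)))"

locale torsion_group = group +
  assumes torsion: "x \<in> carrier G \<Longrightarrow> \<exists>m::nat. m > 0 \<and> x [^] m = \<one>"

text \<open>
  \<^const>\<open>group.ord\<close> is 0 on elements of infinite order, so this is the set of
  element orders in the usual sense only for torsion groups.
\<close>

definition element_orders :: "('a, 'b) monoid_scheme \<Rightarrow> nat set" where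
  "element_orders G = group.ord G ` carrier G"

definition prime_Omega :: "nat \<Rightarrow> nat" where
  "prime_Omega n = size (prime_factorization n)"

definition reduced_power_graph :: "('a, 'b) monoid_scheme \<Rightarrow> 'a ugraph" where
  "reduced_power_graph G =
     \<lparr> vertices = carrier G,
       edges = {{u, v} | u v. u \<in> carrier G \<and> v \<in> carrier G \<and>
                  (generate G {v} \<subset> generate G {u} \<or> generate G {u} \<subset> generate G {v})} \<rparr>"

lemma simple_reduced_power_graph: "simple_ugraph (reduced_power_graph G)"
  unfolding simple_ugraph_def reduced_power_graph_def by (auto simp: card_2_iff)

lemma reduced_power_graph_adjacent_iff:
  assumes "u \<in> carrier G" "v \<in> carrier G"
  shows "{u, v} \<in> edges (reduced_power_graph G) \<longleftrightarrow>
    generate G {v} \<subset> generate G {u} \<or> generate G {u} \<subset> generate G {v}"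
  using assms unfolding reduced_power_graph_def by (auto simp: doubleton_eq_iff)

end

theory Submission
  imports Defs
begin

text \<open>
  In a torsion group, \<open>\<langle>v\<rangle> \<subset> \<langle>u\<rangle>\<close> makes the order of \<open>v\<close> a proper divisor of the order of \<open>u\<close>, so
  \<open>\<Omega>\<close> of the order separates adjacent vertices. As \<open>\<Omega>\<close> takes values in \<open>{0, \<dots>, \<Omega>(n)}\<close> on element
  orders, this is a proper colouring with \<open>\<Omega>(n) + 1\<close> colours (\<open>proper_colouring_prime_Omega_ord\<close>).
  Conversely, starting from an element \<open>x\<close> of order \<open>n\<close> and repeatedly raising to a prime
  dividing the current order, one runs down a strict chain of cyclic subgroups of length
  \<open>\<Omega>(n) + 1\<close> ending in the trivial one; its generators form a clique (\<open>clique_in_cyclic\<close>).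

  A clique of size \<open>k\<close> together with a proper colouring with \<open>k\<close> colours forces both the clique
  number and the chromatic number to be \<open>k\<close>; moreover every colour occurs on the clique, so the
  colour classes are \<open>k\<close> nonempty independent parts.
\<close>

section \<open>Cliques and colourings of matching size\<close>

lemma proper_colouring_inj_on_clique:
  assumes "proper_colouring \<Gamma> k c" and "K \<subseteq> vertices \<Gamma>" and "clique K (edges \<Gamma>)"
  shows "inj_on c K"
proof (rule inj_onI, rule ccontr)
  fix u v assume "u \<in> K" "v \<in> K" "c u = c v" "u \<noteq> v"
  then show False
    using assms unfolding proper_colouring_def clique_def by blast
qed

lemma card_clique_le_colours:
  assumes "proper_colouring \<Gamma> k c" and "K \<subseteq> vertices \<Gamma>" and "clique K (edges \<Gamma>)"
  shows "card K \<le> k"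
proof -
  have "c ` K \<subseteq> {..<k}"
    using assms unfolding proper_colouring_def by blast
  then show ?thesis
    using card_inj_on_le[OF proper_colouring_inj_on_clique[OF assms], of "{..<k}"] by simp
qed

lemma clique_number_eqI:
  assumes "proper_colouring \<Gamma> k c"
    and "K \<subseteq> vertices \<Gamma>" "finite K" "clique K (edges \<Gamma>)" "card K = k"
  shows "clique_number \<Gamma> = enat k"
  unfolding clique_number_def
proof (rule antisym)
  show "Sup {enat (card K) |K. K \<subseteq> vertices \<Gamma> \<and> finite K \<and> clique K (edges \<Gamma>)} \<le> enat k"
    by (rule Sup_least) (auto intro: card_clique_le_colours[OF assms(1)])
  show "enat k \<le> Sup {enat (card K) |K. K \<subseteq> vertices \<Gamma> \<and> finite K \<and> clique K (edges \<Gamma>)}"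
    by (rule Sup_upper) (use assms in blast)
qed

lemma chromatic_number_eqI:
  assumes "proper_colouring \<Gamma> k c"
    and "K \<subseteq> vertices \<Gamma>" "clique K (edges \<Gamma>)" "card K = k"
  shows "chromatic_number \<Gamma> = enat k"
  unfolding chromatic_number_def
proof (rule antisym)
  show "Inf {enat k |k. \<exists>c. proper_colouring \<Gamma> k c} \<le> enat k"
    by (rule Inf_lower) (use assms in blast)
  show "enat k \<le> Inf {enat k |k. \<exists>c. proper_colouring \<Gamma> k c}"
    using card_clique_le_colours[OF _ assms(2,3)] assms(4) by (intro Inf_greatest) auto
qed

lemma k_partite_of_surj_colouring:
  assumes col: "proper_colouring \<Gamma> k c" and surj: "c ` vertices \<Gamma> = {..<k}"
  shows "k_partite k \<Gamma>"
proof -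
  define part where "part i = {v \<in> vertices \<Gamma>. c v = i}" for i
  have nonempty: "part i \<noteq> {}" if "i < k" for i
  proof -
    have "i \<in> c ` vertices \<Gamma>" using that surj by simp
    then show ?thesis unfolding part_def by blast
  qed
  have "partition_on (vertices \<Gamma>) (part ` {..<k})"
  proof (rule partition_onI)
    show "\<Union> (part ` {..<k}) = vertices \<Gamma>"
      using surj unfolding part_def by auto
  qed (use nonempty in \<open>auto simp: part_def disjnt_def\<close>)
  moreover have "inj_on part {..<k}"
  proof (rule inj_onI)
    fix i j assume "i \<in> {..<k}" "part i = part j"
    with nonempty obtain v where "v \<in> part i" "v \<in> part j" by blast
    then show "i = j" unfolding part_def by simp
  qed
  then have "card (part ` {..<k}) = k"
    by (simp add: card_image)
  moreover have "indep (part i) (edges \<Gamma>)" for i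
    using col unfolding part_def proper_colouring_def indep_def by blast
  ultimately show ?thesis
    unfolding k_partite_def by blast
qed

lemma k_partite_of_clique:
  assumes col: "proper_colouring \<Gamma> k c"
    and K: "K \<subseteq> vertices \<Gamma>" "clique K (edges \<Gamma>)" "card K = k"
  shows "k_partite k \<Gamma>"
proof (rule k_partite_of_surj_colouring[OF col])
  have sub: "c ` vertices \<Gamma> \<subseteq> {..<k}"
    using col unfolding proper_colouring_def by blast
  have "c ` K = {..<k}"
  proof (rule card_subset_eq)
    show "card (c ` K) = card {..<k}"
      using K card_image[OF proper_colouring_inj_on_clique[OF col K(1,2)]] by simp
  qed (use sub K in auto)
  then show "c ` vertices \<Gamma> = {..<k}"
    using sub K(1) by blast
qed

section \<open>Counting prime factors\<close>

lemma prime_Omega_times_prime: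
  assumes "m \<noteq> 0" and "Factorial_Ring.prime p"
  shows "prime_Omega (p * m) = Suc (prime_Omega m)"
  using assms by (simp add: prime_Omega_def prime_factorization_times_prime)

lemma prime_Omega_less:
  assumes "d dvd m" "d \<noteq> m" "m \<noteq> 0"
  shows "prime_Omega d < prime_Omega m"
proof -
  obtain e where e: "m = d * e" using assms(1) by blast
  with assms have "d \<noteq> 0" "e \<noteq> 0" "e \<noteq> 1" by auto
  then have "prime_factorization e \<noteq> {#}"
    by (simp add: prime_factorization_empty_iff)
  then show ?thesis
    using \<open>d \<noteq> 0\<close> \<open>e \<noteq> 0\<close>
    by (simp add: e prime_Omega_def prime_factorization_mult nonempty_has_size)
qed

section \<open>Cyclic subgroups of a torsion group\<close>

context torsion_group
begin

lemma ord_nonzero: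
  assumes "x \<in> carrier G"
  shows "ord x \<noteq> 0"
proof -
  obtain m :: nat where "m > 0" "x [^] m = \<one>"
    using torsion[OF assms] by blast
  then show ?thesis
    using ord_eq_0[OF assms] by blast
qed

lemma generate_singleton_mono:
  assumes "x \<in> carrier G" and "y \<in> generate G {x}"
  shows "generate G {y} \<subseteq> generate G {x}"
proof (rule generate_subgroup_incl)
  show "subgroup (generate G {x}) G"
    by (rule generate_is_subgroup) (use assms in simp)
qed (use assms in simp)

lemma prime_Omega_ord_less:
  assumes u: "u \<in> carrier G" and v: "v \<in> carrier G"
    and sub: "generate G {v} \<subset> generate G {u}"
  shows "prime_Omega (ord v) < prime_Omega (ord u)"
proof (rule prime_Omega_less)
  have "v \<in> generate G {u}"
    using sub generate.incl[of v "{v}" G] by blast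
  then obtain k :: nat where "v = u [^] k"
    using generate_pow_nat[OF u ord_nonzero[OF u]] by blast
  then have "v [^] ord u = \<one>"
    using u by (simp add: nat_pow_pow pow_eq_id)
  then show "ord v dvd ord u"
    using pow_eq_id[OF v] by blast
  have "finite (generate G {u})"
    using ord_nonzero[OF u] generate_pow_card[OF u] by (simp add: card_ge_0_finite)
  then have "card (generate G {v}) < card (generate G {u})"
    using sub by (rule psubset_card_mono)
  then show "ord v \<noteq> ord u"
    using generate_pow_card u v by simp
qed (rule ord_nonzero[OF u])

lemma proper_colouring_prime_Omega_ord:
  assumes "\<And>x. x \<in> carrier G \<Longrightarrow> prime_Omega (ord x) \<le> N"
  shows "proper_colouring (reduced_power_graph G) (N + 1) (\<lambda>x. prime_Omega (ord x))"
proof -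
  have vert: "vertices (reduced_power_graph G) = carrier G"
    by (simp add: reduced_power_graph_def)
  have "prime_Omega (ord u) \<noteq> prime_Omega (ord v)"
    if "u \<in> carrier G" "v \<in> carrier G" "{u, v} \<in> edges (reduced_power_graph G)" for u v
    using that prime_Omega_ord_less[of u v] prime_Omega_ord_less[of v u]
      reduced_power_graph_adjacent_iff[of u G v] by linarith
  then show ?thesis
    using assms unfolding proper_colouring_def vert by (auto simp: less_Suc_eq_le)
qed

text \<open>
  Keeping the clique inside \<open>\<langle>x\<rangle>\<close> is what makes the induction work: a clique inside the proper
  subgroup \<open>\<langle>x\<^sup>p\<rangle>\<close>, where the prime \<open>p\<close> divides the order of \<open>x\<close>, can be enlarged by \<open>x\<close>.
\<close>

lemma clique_in_cyclic:
  assumes "x \<in> carrier G"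
  shows "\<exists>K \<subseteq> generate G {x}. finite K \<and> clique K (edges (reduced_power_graph G)) \<and>
           card K = prime_Omega (ord x) + 1"
  using assms
proof (induction "prime_Omega (ord x)" arbitrary: x rule: less_induct)
  case less
  note x = \<open>x \<in> carrier G\<close>
  have x_in: "x \<in> generate G {x}" by (simp add: generate.incl)
  show ?case
  proof (cases "ord x = 1")
    case True
    show ?thesis
      by (rule exI[of _ "{x}"]) (use True x_in in \<open>simp add: clique_def prime_Omega_def\<close>)
  next
    case False
    then obtain p where p: "Factorial_Ring.prime p" "p dvd ord x"
      using prime_factor_nat by blast
    define y where "y = x [^] p"
    have y: "y \<in> carrier G" using x y_def by simp
    have "p \<noteq> 0" using p(1) by auto
    then have "ord y = ord x div p"
      using p(2) ord_pow_gen[OF x, of p] by (simp add: y_def gcd_nat.absorb2)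
    then have ord_x: "ord x = p * ord y" using p(2) by simp
    then have Omega: "prime_Omega (ord x) = Suc (prime_Omega (ord y))"
      using prime_Omega_times_prime[OF ord_nonzero[OF y] p(1)] by simp
    have y_in: "y \<in> generate G {x}"
      using generate_pow_nat[OF x ord_nonzero[OF x]] y_def by blast
    have y_sub: "generate G {y} \<subseteq> generate G {x}"
      by (rule generate_singleton_mono[OF x y_in])
    have "generate G {y} \<noteq> generate G {x}"
      using Omega generate_pow_card[OF x] generate_pow_card[OF y] by auto
    then have y_psub: "generate G {y} \<subset> generate G {x}"
      using y_sub by blast
    obtain K where K: "K \<subseteq> generate G {y}" "finite K"
        "clique K (edges (reduced_power_graph G))" "card K = prime_Omega (ord y) + 1"
      using less.hyps[OF _ y] Omega by auto
    have psub: "generate G {z} \<subset> generate G {x}" if "z \<in> K" for z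
      using generate_singleton_mono[OF y] K(1) that y_psub by blast
    then have "x \<notin> K" by blast
    have adj: "{x, z} \<in> edges (reduced_power_graph G)" if "z \<in> K" for z
    proof -
      have "z \<in> carrier G"
        using that K(1) y generate_in_carrier[of "{y}" z] by blast
      then show ?thesis
        using reduced_power_graph_adjacent_iff[OF x] psub[OF that] by blast
    qed
    have "clique (insert x K) (edges (reduced_power_graph G))"
      unfolding clique_def
    proof (intro ballI impI)
      fix v w assume vw: "v \<in> insert x K" "w \<in> insert x K" "v \<noteq> w"
      show "{v, w} \<in> edges (reduced_power_graph G)"
      proof (cases "v = x \<or> w = x")
        case True
        then show ?thesis using vw adj by (metis insertE insert_commute)
      next
        case False
        then show ?thesis using vw K(3) unfolding clique_def by blast
      qed
    qed
    moreover have "insert x K \<subseteq> generate G {x}"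
      using K(1) x_in y_sub by blast
    moreover have "card (insert x K) = prime_Omega (ord x) + 1"
      using K(2,4) \<open>x \<notin> K\<close> Omega by simp
    ultimately show ?thesis
      using K(2) by blast
  qed
qed

end

section \<open>The reduced power graph of a torsion group\<close>

theorem corollary2p1:
  fixes G :: "('a, 'b) monoid_scheme" and n :: nat
  assumes "torsion_group G"
    and "n \<in> element_orders G"
    and "\<forall>m\<in>element_orders G. prime_Omega m \<le> prime_Omega n"
  shows "k_partite (prime_Omega n + 1) (reduced_power_graph G) \<and>
    clique_number (reduced_power_graph G) = enat (prime_Omega n + 1) \<and>
    enat (prime_Omega n + 1) = chromatic_number (reduced_power_graph G) \<and>
    weakly_chi_perfect (reduced_power_graph G)"
proof -
  interpret torsion_group G by fact
  obtain x where x: "x \<in> carrier G" "n = ord x"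
    using assms(2) unfolding element_orders_def by blast
  have col: "proper_colouring (reduced_power_graph G) (prime_Omega n + 1)
      (\<lambda>x. prime_Omega (ord x))"
    using assms(3) by (intro proper_colouring_prime_Omega_ord) (simp add: element_orders_def)
  obtain K where K: "K \<subseteq> generate G {x}" "finite K"
      "clique K (edges (reduced_power_graph G))" "card K = prime_Omega n + 1"
    using clique_in_cyclic[OF x(1)] x(2) by blast
  have sub: "K \<subseteq> vertices (reduced_power_graph G)"
    using K(1) generate_incl[of "{x}"] x(1) by (auto simp: reduced_power_graph_def)
  show ?thesis
    using k_partite_of_clique[OF col sub K(3,4)] clique_number_eqI[OF col sub K(2,3,4)]
      chromatic_number_eqI[OF col sub K(3,4)]
    unfolding weakly_chi_perfect_def by simp
qed

end
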